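(* Let $G_1,G_2$ be finite simple graphs, and for $i=1,2$ let $\mathcal G_i$ be a gadget in $G_i$ with parameter tuple $(a_i,t_i,s_i,o_i,h_i,v_i)$, code $I_i$, transversals $P^{\mathrm H}_i,P^{\mathrm V}_i$, auxiliary set $X_i=O_i\mathbin{\dot\cup}H_i\mathbin{\dot\cup}V_i$, set of centers $R_i$, and $B_i=I_i\setminus R_i$. Define the set-valued map $L_1:X_2\to 2^{V(G_1)}$ by $$L_1(x)=\begin{cases}R_1,&x\in O_2,\\ P^{\mathrm H}_1,&x\in H_2,\\ P^{\mathrm V}_1,&x\in V_2,\end{cases}$$ and the set-valued map $K_2:X_1\to 2^{V(G_2)}$ by $$K_2(y)=\begin{cases}R_2,&y\in O_1,\\ P^{\mathrm V}_2,&y\in H_1,\\ P^{\mathrm H}_2,&y\in V_1.\end{cases}$$ Define $$A_H=\{(p,x):x\in X_2,\ p\in L_1(x)\},\qquad A_V=\{(y,q):y\in X_1,\ q\in K_2(y)\},$$ $$I_{12}=(B_1\times B_2)\cup A_H\cup A_V.$$ Then $I_{12}$ is an independent set in the strong product $G_1\boxtimes G_2$ and $$a_{12}=|I_{12}|=(a_1-t_1)(a_2-t_2)+t_1s_2+s_1t_2.$$ Moreover, $I_{12}$ is the code of a gadget $\mathcal G_{12}$ in $G_1\boxtimes G_2$ with parameter tuple $(a_{12},t_{12},s_{12},o_{12},h_{12},v_{12})$, where $$t_{12}=t_1o_2+o_1t_2,$$ $$s_{12}=s_1s_2,$$ $$o_{12}=o_1o_2+(h_1+v_1)(h_2+v_2),$$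 $$h_{12}=h_1o_2+o_1v_2,$$ $$v_{12}=v_1o_2+o_1h_2.$$
   Context: For vertices $u,v$ of a graph $G$, write $u\simeq v$ (and say $u$ and $v$ are confusable) if $u=v$ or $\{u,v\}\in E(G)$. For $S\subseteq V(G)$, let $N(S)=\{x\in V(G): x\simeq s\text{ for some }s\in S\}$ be the closed neighborhood of $S$. The strong product $G_1\boxtimes G_2$ has vertex set $V(G_1)\times V(G_2)$ and satisfies $(x_1,x_2)\simeq(y_1,y_2)$ if and only if $x_1\simeq y_1$ and $x_2\simeq y_2$. Private pair: let $I$ be an independent set in $G$. A pair $(r,q)$ of vertices is a private pair for $I$ if $r\in I$, $q\notin I$, and $N(\{q\})\cap I=\{r\}$. The point $r$ is the center, $q$ is its private neighbor, and both are called endpoints of the private pair. Gadget: a gadget in $G$ consists of the following data. (1) An independent set $I\subseteq V(G)$ of size $a$, called the code of the gadget. (2) Private pairs $(r_i,q_i)$, $1\le i\le t$, for $I$ with pairwise disjoint endpoint sets $\{r_i,q_i\}$ (hence with distinct centers). (3) Two complementary transversals $P^{\mathrm H},P^{\mathrm V}$ of the pair endpoints: $P^{\mathrm H}$ and $P^{\mathrm V}$ consist of pair endpoints, and for every $i$, one of $r_i,q_i$ belongs to $P^{\mathrm H}$ and the other belongs to $P^{\mathrm V}$ (so $|P^{\mathrm H}|=|P^{\mathrm V}|=t$). Both $P^{\mathrm H}$ and $P^{\mathrm V}$ are independent in $G$. (4) An independent set $X$ of $G$ (the auxiliary set) such that $X\cap N(P^{\mathrm H})\cap N(P^{\mathrm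 V})=\emptyset$. Write $O=X\setminus(N(P^{\mathrm H})\cup N(P^{\mathrm V}))$, $H=X\cap N(P^{\mathrm H})$, $V=X\cap N(P^{\mathrm V})$, and $(s,o,h,v)=(|X|,|O|,|H|,|V|)$. Thus $X=O\mathbin{\dot\cup}H\mathbin{\dot\cup}V$ and $s=o+h+v$. The tuple $(a,t,s,o,h,v)$ is the parameter tuple of the gadget. Further, $R=\{r_1,\ldots,r_t\}$ denotes the set of centers and $B=I\setminus R$. Subscripts $1,2$ refer to the data of the gadgets in $G_1,G_2$. *)

theory Defs
  imports Main "HOL-Library.Disjoint_Sets"
begin

record 'a sgraph =
  verts :: "'a set"
  edges :: "'a set set"

definition fin_simple_graph :: "'a sgraph \<Rightarrow> bool" where
  "fin_simple_graph G \<longleftrightarrow>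
     finite (verts G) \<and>
     (\<forall>e\<in>edges G. \<exists>u\<in>verts G. \<exists>v\<in>verts G. u \<noteq> v \<and> e = {u, v})"

definition confusable :: "'a sgraph \<Rightarrow> 'a \<Rightarrow> 'a \<Rightarrow> bool" where
  "confusable G u v \<longleftrightarrow> u = v \<or> {u, v} \<in> edges G"

definition closed_nbhd :: "'a sgraph \<Rightarrow> 'a set \<Rightarrow> 'a set" where
  "closed_nbhd G S = {x \<in> verts G. \<exists>s\<in>S. confusable G x s}"

definition independent :: "'a sgraph \<Rightarrow> 'a set \<Rightarrow> bool" where
  "independent G S \<longleftrightarrow> S \<subseteq> verts G \<and> (\<forall>u\<in>S. \<forall>v\<in>S. {u, v} \<notin> edges G)"

definition strong_product :: "'a sgraph \<Rightarrow> 'b sgraph \<Rightarrow> ('a \<times> 'b) sgraph"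
    (infixr "\<boxtimes>" 75) where
  "G\<^sub>1 \<boxtimes> G\<^sub>2 =
     \<lparr> verts = verts G\<^sub>1 \<times> verts G\<^sub>2,
       edges = {{(x\<^sub>1, x\<^sub>2), (y\<^sub>1, y\<^sub>2)} | x\<^sub>1 x\<^sub>2 y\<^sub>1 y\<^sub>2.
                  x\<^sub>1 \<in> verts G\<^sub>1 \<and> y\<^sub>1 \<in> verts G\<^sub>1 \<and> x\<^sub>2 \<in> verts G\<^sub>2 \<and> y\<^sub>2 \<in> verts G\<^sub>2 \<and>
                  (x\<^sub>1, x\<^sub>2) \<noteq> (y\<^sub>1, y\<^sub>2) \<and>
                  confusable G\<^sub>1 x\<^sub>1 y\<^sub>1 \<and> confusable G\<^sub>2 x\<^sub>2 y\<^sub>2} \<rparr>"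

lemma confusable_sym: "confusable G u v \<longleftrightarrow> confusable G v u"
  by (auto simp: confusable_def insert_commute)

lemma fin_simple_graph_strong_product:
  assumes "fin_simple_graph G\<^sub>1" "fin_simple_graph G\<^sub>2"
  shows "fin_simple_graph (G\<^sub>1 \<boxtimes> G\<^sub>2)"
  using assms unfolding fin_simple_graph_def strong_product_def by auto

lemma confusable_strong_product:
  assumes "x\<^sub>1 \<in> verts G\<^sub>1" "y\<^sub>1 \<in> verts G\<^sub>1" "x\<^sub>2 \<in> verts G\<^sub>2" "y\<^sub>2 \<in> verts G\<^sub>2"
  shows "confusable (G\<^sub>1 \<boxtimes> G\<^sub>2) (x\<^sub>1, x\<^sub>2) (y\<^sub>1, y\<^sub>2) \<longleftrightarrow>
           confusable G\<^sub>1 x\<^sub>1 y\<^sub>1 \<and> confusable G\<^sub>2 x\<^sub>2 y\<^sub>2"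
proof -
  have "{(x\<^sub>1, x\<^sub>2), (y\<^sub>1, y\<^sub>2)} \<in> edges (G\<^sub>1 \<boxtimes> G\<^sub>2) \<longleftrightarrow>
          (x\<^sub>1, x\<^sub>2) \<noteq> (y\<^sub>1, y\<^sub>2) \<and> confusable G\<^sub>1 x\<^sub>1 y\<^sub>1 \<and> confusable G\<^sub>2 x\<^sub>2 y\<^sub>2"
    using assms confusable_sym[of G\<^sub>1] confusable_sym[of G\<^sub>2]
    unfolding strong_product_def by (auto simp: doubleton_eq_iff)
  moreover have "confusable G\<^sub>1 x\<^sub>1 x\<^sub>1" "confusable G\<^sub>2 x\<^sub>2 x\<^sub>2"
    by (simp_all add: confusable_def)
  ultimately show ?thesis
    unfolding confusable_def[of "G\<^sub>1 \<boxtimes> G\<^sub>2"] by auto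
qed

definition private_pair :: "'a sgraph \<Rightarrow> 'a set \<Rightarrow> 'a \<Rightarrow> 'a \<Rightarrow> bool" where
  "private_pair G I r q \<longleftrightarrow>
     r \<in> I \<and> q \<in> verts G \<and> q \<notin> I \<and> closed_nbhd G {q} \<inter> I = {r}"

definition endpoints :: "'a \<times> 'a \<Rightarrow> 'a set" where
  "endpoints p = {fst p, snd p}"

text \<open>
  The private pairs \<open>(r\<^sub>i, q\<^sub>i)\<close>, \<open>1 \<le> i \<le> t\<close>, are kept as a set of pairs
  (center first); as their endpoint sets are disjoint, the pairs are distinct, so nothing is lost
  and \<open>t\<close> is the cardinality of the set.
\<close>
record 'a gadget =
  gcode :: "'a set"
  gpairs :: "('a \<times> 'a) set"
  transH :: "'a set"
  transV :: "'a set"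
  gaux :: "'a set"

definition complementary_transversals ::
    "('a \<times> 'a) set \<Rightarrow> 'a set \<Rightarrow> 'a set \<Rightarrow> bool" where
  "complementary_transversals M P Q \<longleftrightarrow>
     P \<subseteq> (\<Union>p\<in>M. endpoints p) \<and> Q \<subseteq> (\<Union>p\<in>M. endpoints p) \<and> P \<inter> Q = {} \<and>
     (\<forall>(r, q)\<in>M. (r \<in> P \<and> q \<in> Q) \<or> (q \<in> P \<and> r \<in> Q))"

definition is_gadget :: "'a sgraph \<Rightarrow> 'a gadget \<Rightarrow> bool" where
  "is_gadget G g \<longleftrightarrow>
     independent G (gcode g) \<and>
     (\<forall>(r, q)\<in>gpairs g. private_pair G (gcode g) r q) \<and>
     disjoint_family_on endpoints (gpairs g) \<and>
     complementary_transversals (gpairs g) (transH g) (transV g) \<and>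
     independent G (transH g) \<and> independent G (transV g) \<and>
     independent G (gaux g) \<and>
     gaux g \<inter> closed_nbhd G (transH g) \<inter> closed_nbhd G (transV g) = {}"

definition partO :: "'a sgraph \<Rightarrow> 'a gadget \<Rightarrow> 'a set" where
  "partO G g = gaux g - (closed_nbhd G (transH g) \<union> closed_nbhd G (transV g))"

definition partH :: "'a sgraph \<Rightarrow> 'a gadget \<Rightarrow> 'a set" where
  "partH G g = gaux g \<inter> closed_nbhd G (transH g)"

definition partV :: "'a sgraph \<Rightarrow> 'a gadget \<Rightarrow> 'a set" where
  "partV G g = gaux g \<inter> closed_nbhd G (transV g)"

definition parameters ::
    "'a sgraph \<Rightarrow> 'a gadget \<Rightarrow> nat \<times> nat \<times> nat \<times> nat \<times> nat \<times> nat" where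
  "parameters G g =
     (card (gcode g), card (gpairs g), card (gaux g),
      card (partO G g), card (partH G g), card (partV G g))"

definition centers :: "'a gadget \<Rightarrow> 'a set" where
  "centers g = fst ` gpairs g"

definition noncenters :: "'a gadget \<Rightarrow> 'a set" where
  "noncenters g = gcode g - centers g"

text \<open>
  Only the values of \<open>mapL G\<^sub>2 g\<^sub>1 g\<^sub>2\<close> on \<open>gaux g\<^sub>2\<close> and of \<open>mapK G\<^sub>1 g\<^sub>1 g\<^sub>2\<close>
  on \<open>gaux g\<^sub>1\<close> matter; on these sets, for gadgets, exactly one of the first three cases applies.
\<close>
definition mapL :: "'b sgraph \<Rightarrow> 'a gadget \<Rightarrow> 'b gadget \<Rightarrow> 'b \<Rightarrow> 'a set" where
  "mapL G\<^sub>2 g\<^sub>1 g\<^sub>2 x =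
     (if x \<in> partO G\<^sub>2 g\<^sub>2 then centers g\<^sub>1
      else if x \<in> partH G\<^sub>2 g\<^sub>2 then transH g\<^sub>1
      else if x \<in> partV G\<^sub>2 g\<^sub>2 then transV g\<^sub>1
      else {})"

definition mapK :: "'a sgraph \<Rightarrow> 'a gadget \<Rightarrow> 'b gadget \<Rightarrow> 'a \<Rightarrow> 'b set" where
  "mapK G\<^sub>1 g\<^sub>1 g\<^sub>2 y =
     (if y \<in> partO G\<^sub>1 g\<^sub>1 then centers g\<^sub>2
      else if y \<in> partH G\<^sub>1 g\<^sub>1 then transV g\<^sub>2
      else if y \<in> partV G\<^sub>1 g\<^sub>1 then transH g\<^sub>2
      else {})"

definition armH :: "'b sgraph \<Rightarrow> 'a gadget \<Rightarrow> 'b gadget \<Rightarrow> ('a \<times> 'b) set" where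
  "armH G\<^sub>2 g\<^sub>1 g\<^sub>2 = {(p, x). x \<in> gaux g\<^sub>2 \<and> p \<in> mapL G\<^sub>2 g\<^sub>1 g\<^sub>2 x}"

definition armV :: "'a sgraph \<Rightarrow> 'a gadget \<Rightarrow> 'b gadget \<Rightarrow> ('a \<times> 'b) set" where
  "armV G\<^sub>1 g\<^sub>1 g\<^sub>2 = {(y, q). y \<in> gaux g\<^sub>1 \<and> q \<in> mapK G\<^sub>1 g\<^sub>1 g\<^sub>2 y}"

definition product_code ::
    "'a sgraph \<Rightarrow> 'b sgraph \<Rightarrow> 'a gadget \<Rightarrow> 'b gadget \<Rightarrow> ('a \<times> 'b) set" where
  "product_code G\<^sub>1 G\<^sub>2 g\<^sub>1 g\<^sub>2 =
     (noncenters g\<^sub>1 \<times> noncenters g\<^sub>2) \<union> armH G\<^sub>2 g\<^sub>1 g\<^sub>2 \<union> armV G\<^sub>1 g\<^sub>1 g\<^sub>2"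

end

theory Submission
  imports Defs
begin

text \<open>
  Every pair endpoint is non-confusable with every code vertex other than its own center, and a
  vertex of \<open>O\<close> is non-confusable with every endpoint. Hence two confusable product codewords
  lie in one of the three blocks and coincide, unless \<open>(p, x)\<close> from the horizontal arm
  meets \<open>(y, q)\<close> from the vertical one; then neither \<open>x\<close> nor \<open>y\<close> lies in \<open>O\<close>, and because the vertical arm uses the transversals in the
  opposite order, \<open>x\<close> would have to lie in both \<open>H\<close> and \<open>V\<close>.
  The new gadget lifts the private pairs of one factor along the \<open>O\<close>-part of the other and has the
  auxiliary set \<open>X\<^sub>1 \<times> X\<^sub>2\<close>.
\<close>

section \<open>Confusability, independence and counting tools\<close>

lemma confusable_refl [simp]: "confusable G u u"
  by (simp add: confusable_def)

text \<open>An edge of the product records confusability in both coordinates, possibly with its two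
  ends swapped, hence the appeal to symmetry; equal pairs are covered by reflexivity. In this
  projection form, confusability passes to the factors for arbitrary pairs.\<close>

lemma confusable_strong_productD:
  assumes "confusable (G\<^sub>1 \<boxtimes> G\<^sub>2) (x\<^sub>1, x\<^sub>2) (y\<^sub>1, y\<^sub>2)"
  shows "confusable G\<^sub>1 x\<^sub>1 y\<^sub>1" "confusable G\<^sub>2 x\<^sub>2 y\<^sub>2"
proof -
  have "confusable G\<^sub>1 x\<^sub>1 y\<^sub>1 \<and> confusable G\<^sub>2 x\<^sub>2 y\<^sub>2"
  proof (cases "(x\<^sub>1, x\<^sub>2) = (y\<^sub>1, y\<^sub>2)")
    case False
    then have "{(x\<^sub>1, x\<^sub>2), (y\<^sub>1, y\<^sub>2)} \<in> edges (G\<^sub>1 \<boxtimes> G\<^sub>2)"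
      using assms unfolding confusable_def by blast
    then show ?thesis
      by (auto simp: strong_product_def doubleton_eq_iff confusable_sym)
  qed simp
  then show "confusable G\<^sub>1 x\<^sub>1 y\<^sub>1" "confusable G\<^sub>2 x\<^sub>2 y\<^sub>2" by auto
qed

lemma verts_strong_product [simp]: "verts (G\<^sub>1 \<boxtimes> G\<^sub>2) = verts G\<^sub>1 \<times> verts G\<^sub>2"
  by (simp add: strong_product_def)

text \<open>\<open>independent\<close> also forbids \<open>{u, u}\<close> from being an edge; simple
  graphs have no such edges, so only distinct confusable vertices can violate independence.\<close>

lemma independent_iff:
  assumes "fin_simple_graph G"
  shows "independent G S \<longleftrightarrow>
    S \<subseteq> verts G \<and> (\<forall>u\<in>S. \<forall>v\<in>S. confusable G u v \<longrightarrow> u = v)"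
proof -
  have "{u, u} \<notin> edges G" for u
    using assms unfolding fin_simple_graph_def by (metis doubleton_eq_iff)
  then show ?thesis
    unfolding independent_def confusable_def by metis
qed

lemma independentD:
  "independent G S \<Longrightarrow> u \<in> S \<Longrightarrow> v \<in> S \<Longrightarrow> confusable G u v \<Longrightarrow> u = v"
  unfolding independent_def confusable_def by blast

lemma independent_mono: "independent G S \<Longrightarrow> T \<subseteq> S \<Longrightarrow> independent G T"
  unfolding independent_def by blast

lemma independent_Times:
  assumes "fin_simple_graph G\<^sub>1" "fin_simple_graph G\<^sub>2" "independent G\<^sub>1 S" "independent G\<^sub>2 T"
  shows "independent (G\<^sub>1 \<boxtimes> G\<^sub>2) (S \<times> T)"
  using assms
  by (auto simp: independent_iff fin_simple_graph_strong_product dest: confusable_strong_productD)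

lemma independent_Un:
  assumes "fin_simple_graph G" "independent G S" "independent G T"
    and "\<And>u v. u \<in> S \<Longrightarrow> v \<in> T \<Longrightarrow> \<not> confusable G u v"
  shows "independent G (S \<union> T)"
  using assms by (auto simp: independent_iff) (metis confusable_sym)

lemma private_pairD:
  "private_pair G I r q \<Longrightarrow> b \<in> I \<Longrightarrow> I \<subseteq> verts G \<Longrightarrow> confusable G b q \<Longrightarrow> b = r"
  unfolding private_pair_def closed_nbhd_def by auto

text \<open>Reduces privacy to one uniqueness claim about codewords near \<open>q\<close>. That
  \<open>q\<close> lies outside the code comes for free: it is confusable with \<open>r\<close> but
  different from it.\<close>

lemma private_pairI:
  assumes "independent G I" "r \<in> I" "q \<in> verts G" "q \<noteq> r" "confusable G r q"
    and "\<And>b. b \<in> I \<Longrightarrow> confusable G b q \<Longrightarrow> b = r"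
  shows "private_pair G I r q"
  unfolding private_pair_def
proof (intro conjI)
  show "q \<notin> I" using independentD[OF assms(1,2), of q] assms(4,5) by blast
  have "r \<in> verts G" using assms(1,2) by (auto simp: independent_def)
  then have "r \<in> closed_nbhd G {q} \<inter> I" using assms(2,5) by (simp add: closed_nbhd_def)
  moreover have "b = r" if "b \<in> closed_nbhd G {q} \<inter> I" for b
    using that assms(6)[of b] by (simp add: closed_nbhd_def)
  ultimately show "closed_nbhd G {q} \<inter> I = {r}" by blast
qed (fact assms(2,3))+

text \<open>Disjointness is asked of the \<open>C\<close> factors alone: these will be the three
  parts of an auxiliary set, whereas the \<open>A\<close> factors will be the centers and the two
  transversals, which overlap because every center lies in a transversal.\<close>

lemma card_three_blocks:
  assumes "finite A" "finite A'" "finite A''" "finite C" "finite C'" "finite C''"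
    and "C \<inter> C' = {}" "C \<inter> C'' = {}" "C' \<inter> C'' = {}"
  shows "card (A \<times> C \<union> A' \<times> C' \<union> A'' \<times> C'') =
      card A * card C + card A' * card C' + card A'' * card C''"
    and "card (C \<times> A \<union> C' \<times> A' \<union> C'' \<times> A'') =
      card C * card A + card C' * card A' + card C'' * card A''"
  using assms by (subst card_Un_disjoint; auto simp: card_cartesian_product card_Un_disjoint)+

lemma card_two_blocks:
  assumes "finite A" "finite A'" "finite C" "finite C'" "A \<inter> A' = {}"
  shows "card (A \<times> C \<union> A' \<times> C') = card A * card C + card A' * card C'"
  using assms by (subst card_Un_disjoint) (auto simp: card_cartesian_product)

section \<open>Properties of a single gadget\<close>

locale gadget_graph =
  fixes G :: "'a sgraph" and g :: "'a gadget"
  assumes fin: "fin_simple_graph G" and gadget: "is_gadget G g"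
begin

abbreviation (input) "B \<equiv> noncenters g"
abbreviation (input) "R \<equiv> centers g"
abbreviation (input) "PH \<equiv> transH g"
abbreviation (input) "PV \<equiv> transV g"
abbreviation (input) "X \<equiv> gaux g"
abbreviation (input) "XO \<equiv> partO G g"
abbreviation (input) "XH \<equiv> partH G g"
abbreviation (input) "XV \<equiv> partV G g"
abbreviation (input) "M \<equiv> gpairs g"

lemma indep_code: "independent G (gcode g)"
  and private_code: "(r, q) \<in> M \<Longrightarrow> private_pair G (gcode g) r q"
  and disj_endpoints: "disjoint_family_on endpoints M"
  and transversals: "complementary_transversals M PH PV"
  and indep_transH: "independent G PH"
  and indep_transV: "independent G PV"
  and indep_aux: "independent G X"
  and aux_disj: "X \<inter> closed_nbhd G PH \<inter> closed_nbhd G PV = {}"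
  using gadget unfolding is_gadget_def by auto

lemma finite_verts: "finite (verts G)"
  using fin by (simp add: fin_simple_graph_def)

lemma code_subset: "gcode g \<subseteq> verts G" and transH_subset: "PH \<subseteq> verts G"
  and transV_subset: "PV \<subseteq> verts G" and aux_subset: "X \<subseteq> verts G"
  using indep_code indep_transH indep_transV indep_aux by (auto simp: independent_def)

lemma transversals_disjoint: "PH \<inter> PV = {}"
  using transversals by (simp add: complementary_transversals_def)

lemma pair_in_trans: "(r, q) \<in> M \<Longrightarrow> r \<in> PH \<and> q \<in> PV \<or> q \<in> PH \<and> r \<in> PV"
  using transversals unfolding complementary_transversals_def by blast

lemma trans_Un: "PH \<union> PV = (\<Union>(r, q)\<in>M. {r, q})"
proof
  have "(\<Union>p\<in>M. endpoints p) = (\<Union>(r, q)\<in>M. {r, q})"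
    by (simp add: endpoints_def split_beta)
  then show "PH \<union> PV \<subseteq> (\<Union>(r, q)\<in>M. {r, q})"
    using transversals by (simp add: complementary_transversals_def)
  show "(\<Union>(r, q)\<in>M. {r, q}) \<subseteq> PH \<union> PV"
    by (auto dest: pair_in_trans)
qed

lemma trans_endpoint: "e \<in> PH \<or> e \<in> PV \<Longrightarrow> \<exists>(r, q)\<in>M. e = r \<or> e = q"
  using trans_Un by blast

lemma centers_subset_code: "R \<subseteq> gcode g"
  using private_code unfolding centers_def private_pair_def by force

lemma indep_centers: "independent G R"
  using independent_mono[OF indep_code centers_subset_code] .

lemma indep_noncenters: "independent G B"
  by (rule independent_mono[OF indep_code]) (auto simp: noncenters_def)

lemma centers_subset_trans: "R \<subseteq> PH \<union> PV"
  using trans_Un unfolding centers_def by force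

text \<open>The endpoint is either a center, and then independence of the code applies, or a private
  neighbor, whose only confusable codeword is its center. Either way \<open>b\<close> would be a
  center.\<close>

lemma noncenter_endpoint:
  assumes "b \<in> B" "e \<in> PH \<or> e \<in> PV" shows "\<not> confusable G b e"
proof
  assume c: "confusable G b e"
  obtain r q where rq: "(r, q) \<in> M" "e = r \<or> e = q"
    using trans_endpoint[OF assms(2)] by blast
  have r: "r \<in> R" using rq(1) unfolding centers_def by force
  have b: "b \<in> gcode g" "b \<notin> R" using assms(1) by (auto simp: noncenters_def)
  have "b = r"
    using rq(2) c independentD[OF indep_code b(1), of r] centers_subset_code r
      private_pairD[OF private_code[OF rq(1)] b(1) code_subset] by blast
  then show False using r b(2) by simp
qed

lemma partO_endpoint: "y \<in> XO \<Longrightarrow> e \<in> PH \<or> e \<in> PV \<Longrightarrow> \<not> confusable G y e"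
  using aux_subset unfolding partO_def by (auto simp: closed_nbhd_def)

text \<open>A vertex is confusable with itself, so an endpoint inside \<open>XO\<close> would
  contradict \<open>partO_endpoint\<close>. In the product this keeps pairs lifted from different
  factors apart.\<close>

lemma transH_partO: "PH \<inter> XO = {}" and transV_partO: "PV \<inter> XO = {}"
  using partO_endpoint confusable_refl[of G] unfolding disjoint_iff by fast+

lemma center_private:
  assumes "(r, q) \<in> M" "c \<in> R" "confusable G c q" shows "c = r"
  using private_pairD[OF private_code[OF assms(1)] _ code_subset assms(3)] assms(2)
    centers_subset_code by blast

lemma pair_facts:
  assumes "(r, q) \<in> M"
  shows "r \<in> R" "r \<in> verts G" "q \<in> verts G" "q \<noteq> r" "confusable G r q"
proof -
  have p: "private_pair G (gcode g) r q" using private_code assms by simp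
  show "r \<in> R" using assms unfolding centers_def by force
  show "r \<in> verts G" "q \<in> verts G" "q \<noteq> r"
    using p code_subset by (auto simp: private_pair_def)
  show "confusable G r q"
    using p unfolding private_pair_def closed_nbhd_def by auto
qed

lemma finite_pairs: "finite M"
  by (rule finite_subset[of _ "verts G \<times> verts G"])
    (auto simp: finite_verts dest: pair_facts(2,3))

lemma aux_split: "X = XO \<union> XH \<union> XV"
  and partO_partH: "XO \<inter> XH = {}" and partO_partV: "XO \<inter> XV = {}"
  and partH_partV: "XH \<inter> XV = {}"
  using aux_disj by (auto simp: partO_def partH_def partV_def)

lemma parts_subset: "XO \<subseteq> X" "XH \<subseteq> X" "XV \<subseteq> X"
  using aux_split by auto

lemma partH_iff: "y \<in> X \<Longrightarrow> y \<in> XH \<longleftrightarrow> (\<exists>p\<in>PH. confusable G y p)"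
  and partV_iff: "y \<in> X \<Longrightarrow> y \<in> XV \<longleftrightarrow> (\<exists>p\<in>PV. confusable G y p)"
  using aux_subset by (auto simp: partH_def partV_def closed_nbhd_def)

lemma finite_aux: "finite X"
  using finite_verts aux_subset finite_subset by blast

lemma finite_parts: "finite XO" "finite XH" "finite XV"
  using finite_aux parts_subset finite_subset by blast+

lemma finite_trans: "finite PH" "finite PV" "finite R" "finite B"
  using finite_verts transH_subset transV_subset indep_centers indep_noncenters
  by (auto simp: independent_def dest: finite_subset)

lemma card_aux: "card X = card XO + card XH + card XV"
  using aux_split partO_partH partO_partV partH_partV finite_parts
  by (metis card_Un_disjoint finite_UnI Int_Un_distrib2 Un_empty)

lemma pair_unique:
  assumes "(r, q) \<in> M" "(r', q') \<in> M" "{r, q} \<inter> {r', q'} \<noteq> {}"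
  shows "r = r' \<and> q = q'"
  using disjoint_family_onD[OF disj_endpoints assms(1,2)] assms(3)
  unfolding endpoints_def by auto

lemma card_centers: "card R = card M"
  unfolding centers_def
  by (rule card_image) (auto simp: inj_on_def dest: pair_unique)

text \<open>Each pair contributes exactly one endpoint to \<open>P\<close>, and disjointness of the
  endpoint sets makes this choice injective. The symmetric hypothesis treats both transversals at
  once.\<close>

lemma card_transversal:
  assumes "P = PH \<and> Q = PV \<or> P = PV \<and> Q = PH"
  shows "card P = card M"
proof -
  have in_trans: "r \<in> P \<and> q \<in> Q \<or> q \<in> P \<and> r \<in> Q" if "(r, q) \<in> M" for r q
    using pair_in_trans[OF that] assms by blast
  have disj: "P \<inter> Q = {}" using transversals_disjoint assms by blast
  \<comment> \<open>Picks the endpoint that lies in \<open>P\<close>: if \<open>r\<close> is not in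
    \<open>P\<close>, complementarity puts \<open>q\<close> there.\<close>
  let ?f = "\<lambda>(r, q). if r \<in> P then r else q"
  have "P = ?f ` M"
  proof
    show "?f ` M \<subseteq> P" using in_trans by fastforce
    show "P \<subseteq> ?f ` M"
    proof
      fix e assume e: "e \<in> P"
      then obtain r q where rq: "(r, q) \<in> M" "e = r \<or> e = q"
        using trans_endpoint assms by blast
      then have "e = ?f (r, q)" using e in_trans[OF rq(1)] disj by auto
      then show "e \<in> ?f ` M" using rq(1) by blast
    qed
  qed
  moreover have "inj_on ?f M"
    by (auto simp: inj_on_def split: if_splits dest: pair_unique)
  ultimately show ?thesis using card_image by metis
qed

lemma card_transH: "card PH = card M" and card_transV: "card PV = card M"
  using card_transversal by blast+

text \<open>Stated over \<open>int\<close>, where the final count subtracts; the centers form a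
  subset of the code, so the natural-number difference is not truncated.\<close>

lemma card_noncenters: "int (card B) = int (card (gcode g)) - int (card M)"
  unfolding noncenters_def
  using card_Diff_subset[OF finite_trans(3) centers_subset_code] card_centers
    card_mono[OF finite_subset[OF code_subset finite_verts] centers_subset_code]
  by (simp add: of_nat_diff)

end

section \<open>The product code: independence and size\<close>

locale gadget_product =
  L: gadget_graph G\<^sub>1 g\<^sub>1 + R: gadget_graph G\<^sub>2 g\<^sub>2
  for G\<^sub>1 :: "'a sgraph" and g\<^sub>1 :: "'a gadget" and G\<^sub>2 :: "'b sgraph" and g\<^sub>2 :: "'b gadget"
begin

abbreviation (input) "AH \<equiv> armH G\<^sub>2 g\<^sub>1 g\<^sub>2"
abbreviation (input) "AV \<equiv> armV G\<^sub>1 g\<^sub>1 g\<^sub>2"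
abbreviation (input) "P \<equiv> G\<^sub>1 \<boxtimes> G\<^sub>2"

text \<open>The parts O, H, V partition the auxiliary set, so the case distinction in
  \<open>mapL\<close> becomes a union of three rectangles. Counting and membership use this form,
  while independence of the arm is proved fiber by fiber from \<open>armH_def\<close>.\<close>

lemma armH_eq: "AH = centers g\<^sub>1 \<times> R.XO \<union> transH g\<^sub>1 \<times> R.XH \<union> transV g\<^sub>1 \<times> R.XV"
  using R.aux_split R.partO_partH R.partO_partV R.partH_partV
  unfolding armH_def mapL_def by (auto split: if_splits)

lemma armV_eq: "AV = L.XO \<times> centers g\<^sub>2 \<union> L.XH \<times> transV g\<^sub>2 \<union> L.XV \<times> transH g\<^sub>2"
  using L.aux_split L.partO_partH L.partO_partV L.partH_partV
  unfolding armV_def mapK_def by (auto split: if_splits)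

lemma mapL_indep: "independent G\<^sub>1 (mapL G\<^sub>2 g\<^sub>1 g\<^sub>2 x)"
  and mapK_indep: "independent G\<^sub>2 (mapK G\<^sub>1 g\<^sub>1 g\<^sub>2 y)"
  using L.indep_centers L.indep_transH L.indep_transV R.indep_centers R.indep_transH R.indep_transV
  by (auto simp: mapL_def mapK_def independent_def)

lemma mapL_subset: "mapL G\<^sub>2 g\<^sub>1 g\<^sub>2 x \<subseteq> transH g\<^sub>1 \<union> transV g\<^sub>1"
  and mapK_subset: "mapK G\<^sub>1 g\<^sub>1 g\<^sub>2 y \<subseteq> transH g\<^sub>2 \<union> transV g\<^sub>2"
  using L.centers_subset_trans R.centers_subset_trans by (auto simp: mapL_def mapK_def)

lemma armH_D:
  assumes "(p, x) \<in> AH" shows "p \<in> transH g\<^sub>1 \<or> p \<in> transV g\<^sub>1" "x \<in> gaux g\<^sub>2"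
  using assms mapL_subset unfolding armH_def by auto

lemma armV_D:
  assumes "(y, q) \<in> AV" shows "y \<in> gaux g\<^sub>1" "q \<in> transH g\<^sub>2 \<or> q \<in> transV g\<^sub>2"
  using assms mapK_subset unfolding armV_def by auto

lemma fin_product: "fin_simple_graph P"
  using L.fin R.fin by (rule fin_simple_graph_strong_product)

text \<open>Independence of the auxiliary set of the second factor forces equal second coordinates;
  both first coordinates then lie in the same value of \<open>mapL\<close>, which is
  independent.\<close>

lemma indep_armH: "independent P AH"
  unfolding independent_iff[OF fin_product]
proof (intro conjI ballI impI)
  show "AH \<subseteq> verts P"
  proof (rule subrelI)
    fix p x assume "(p, x) \<in> AH"
    then show "(p, x) \<in> verts P"
      using armH_D[of p x] L.transH_subset L.transV_subset R.aux_subset by auto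
  qed
  fix u v assume uv: "u \<in> AH" "v \<in> AH" and c: "confusable P u v"
  obtain p x p' x' where eq: "u = (p, x)" "v = (p', x')" by fastforce
  have "x = x'"
    using independentD[OF R.indep_aux] armH_D(2) uv confusable_strong_productD(2) c eq by metis
  moreover have "p = p'"
    using independentD[OF mapL_indep, of p x p'] uv c eq calculation
    by (auto simp: armH_def dest: confusable_strong_productD)
  ultimately show "u = v" using eq by simp
qed

lemma indep_armV: "independent P AV"
  unfolding independent_iff[OF fin_product]
proof (intro conjI ballI impI)
  show "AV \<subseteq> verts P"
  proof (rule subrelI)
    fix p x assume "(p, x) \<in> AV"
    then show "(p, x) \<in> verts P"
      using armV_D[of p x] R.transH_subset R.transV_subset L.aux_subset by auto
  qed
  fix u v assume uv: "u \<in> AV" "v \<in> AV" and c: "confusable P u v"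
  obtain y q y' q' where eq: "u = (y, q)" "v = (y', q')" by fastforce
  have "y = y'"
    using independentD[OF L.indep_aux] armV_D(1) uv confusable_strong_productD(1) c eq by metis
  moreover have "q = q'"
    using independentD[OF mapK_indep, of q y q'] uv c eq calculation
    by (auto simp: armV_def dest: confusable_strong_productD)
  ultimately show "u = v" using eq by simp
qed

lemma noncenters_armH:
  "u \<in> noncenters g\<^sub>1 \<times> noncenters g\<^sub>2 \<Longrightarrow> v \<in> AH \<Longrightarrow> \<not> confusable P u v"
  using L.noncenter_endpoint armH_D(1) confusable_strong_productD(1)[of G\<^sub>1 G\<^sub>2]
  by (cases u, cases v) blast

lemma noncenters_armV:
  "u \<in> noncenters g\<^sub>1 \<times> noncenters g\<^sub>2 \<Longrightarrow> v \<in> AV \<Longrightarrow> \<not> confusable P u v"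
  using R.noncenter_endpoint armV_D(2) confusable_strong_productD(2)[of G\<^sub>1 G\<^sub>2]
  by (cases u, cases v) blast

lemma armH_armV:
  assumes "u \<in> AH" "v \<in> AV" shows "\<not> confusable P u v"
proof
  assume c: "confusable P u v"
  obtain p x y q where eq: "u = (p, x)" "v = (y, q)" by fastforce
  have c1: "confusable G\<^sub>1 y p" and c2: "confusable G\<^sub>2 x q"
    using confusable_strong_productD c eq confusable_sym by metis+
  have px: "p \<in> transH g\<^sub>1 \<or> p \<in> transV g\<^sub>1" "x \<in> gaux g\<^sub>2" using armH_D assms eq by auto
  have yq: "y \<in> gaux g\<^sub>1" "q \<in> transH g\<^sub>2 \<or> q \<in> transV g\<^sub>2" using armV_D assms eq by auto
  have "x \<notin> R.XO" "y \<notin> L.XO" using R.partO_endpoint L.partO_endpoint px yq c1 c2 by blast+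
  then consider "p \<in> transH g\<^sub>1" "x \<in> R.XH" | "p \<in> transV g\<^sub>1" "x \<in> R.XV"
    using assms(1) eq armH_eq by auto
  then show False
  proof cases
    \<comment> \<open>The contradiction runs once around both factors: \<open>p\<close> places
      \<open>y\<close> in H, over which the vertical arm carries the V-transversal, so
      \<open>q\<close> places \<open>x\<close> in V although \<open>x\<close> is in H.\<close>
    case 1
    then have "y \<in> L.XH" using L.partH_iff yq c1 by blast
    then have "q \<in> transV g\<^sub>2"
      using assms(2) eq armV_eq L.partH_partV \<open>y \<notin> L.XO\<close> by auto
    then have "x \<in> R.XV" using R.partV_iff px c2 by blast
    then show False using 1 R.partH_partV by blast
  next
    case 2
    then have "y \<in> L.XV" using L.partV_iff yq c1 by blast
    then have "q \<in> transH g\<^sub>2"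
      using assms(2) eq armV_eq L.partH_partV \<open>y \<notin> L.XO\<close> by auto
    then have "x \<in> R.XH" using R.partH_iff px c2 by blast
    then show False using 2 R.partH_partV by blast
  qed
qed

abbreviation (input) "code \<equiv> product_code G\<^sub>1 G\<^sub>2 g\<^sub>1 g\<^sub>2"

lemma indep_product_code: "independent P code"
  unfolding product_code_def
  by (intro independent_Un fin_product indep_armH indep_armV
      independent_Times[OF L.fin R.fin L.indep_noncenters R.indep_noncenters])
    (use noncenters_armH noncenters_armV armH_armV in blast)+

lemma card_armH: "card AH = card (gpairs g\<^sub>1) * card (gaux g\<^sub>2)"
  unfolding armH_eq
  by (subst card_three_blocks)
    (simp_all add: L.finite_trans R.finite_parts R.partO_partH R.partO_partV R.partH_partV
      L.card_centers L.card_transH L.card_transV R.card_aux algebra_simps)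

lemma card_armV: "card AV = card (gaux g\<^sub>1) * card (gpairs g\<^sub>2)"
  unfolding armV_eq
  by (subst card_three_blocks)
    (simp_all add: R.finite_trans L.finite_parts L.partO_partH L.partO_partV L.partH_partV
      R.card_centers R.card_transH R.card_transV L.card_aux algebra_simps)

lemma card_product_code:
  "card code = card (noncenters g\<^sub>1) * card (noncenters g\<^sub>2)
    + card (gpairs g\<^sub>1) * card (gaux g\<^sub>2) + card (gaux g\<^sub>1) * card (gpairs g\<^sub>2)"
proof -
  let ?BB = "noncenters g\<^sub>1 \<times> noncenters g\<^sub>2"
  \<comment> \<open>A common element of two blocks would be confusable with itself, so the
    non-confusability of the blocks already gives their disjointness.\<close>
  have "?BB \<inter> AH = {}" "?BB \<inter> AV = {}" "AH \<inter> AV = {}"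
    using noncenters_armH noncenters_armV armH_armV confusable_refl[of P]
    unfolding disjoint_iff by fast+
  then have disj: "?BB \<inter> AH = {}" "(?BB \<union> AH) \<inter> AV = {}"
    by (simp_all add: Int_Un_distrib2)
  have fin: "finite ?BB" "finite AH" "finite AV"
    unfolding armH_eq armV_eq
    by (simp_all add: L.finite_trans R.finite_trans L.finite_parts R.finite_parts)
  show ?thesis
    unfolding product_code_def using disj fin
    by (simp add: card_Un_disjoint card_armH card_armV card_cartesian_product)
qed

section \<open>The product gadget: private pairs, transversals and auxiliary set\<close>

definition lifted_pairs :: "(('a \<times> 'b) \<times> 'a \<times> 'b) set" where
  "lifted_pairs =
    (\<lambda>((r, q), x). ((r, x), (q, x))) ` (gpairs g\<^sub>1 \<times> R.XO) \<union>
    (\<lambda>(y, (r, q)). ((y, r), (y, q))) ` (L.XO \<times> gpairs g\<^sub>2)"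

text \<open>The transversals of the second factor enter in exchanged order, as they do in
  \<open>mapK\<close>. This exchange produces the crossed blocks \<open>L.XO \<times> R.XV\<close>
  in the new H and \<open>L.XO \<times> R.XH\<close> in the new V.\<close>

definition product_gadget :: "('a \<times> 'b) gadget" where
  "product_gadget = \<lparr> gcode = code, gpairs = lifted_pairs,
     transH = transH g\<^sub>1 \<times> R.XO \<union> L.XO \<times> transV g\<^sub>2,
     transV = transV g\<^sub>1 \<times> R.XO \<union> L.XO \<times> transH g\<^sub>2,
     gaux = gaux g\<^sub>1 \<times> gaux g\<^sub>2 \<rparr>"

lemma lifted_pairs_cases:
  assumes "p \<in> lifted_pairs"
  obtains (left) r q x where "(r, q) \<in> gpairs g\<^sub>1" "x \<in> R.XO" "p = ((r, x), (q, x))"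
    | (right) y r q where "(r, q) \<in> gpairs g\<^sub>2" "y \<in> L.XO" "p = ((y, r), (y, q))"
  using assms unfolding lifted_pairs_def by force

lemma pair_not_partO_left: "(r, q) \<in> gpairs g\<^sub>1 \<Longrightarrow> r \<notin> L.XO \<and> q \<notin> L.XO"
  and pair_not_partO_right: "(r', q') \<in> gpairs g\<^sub>2 \<Longrightarrow> r' \<notin> R.XO \<and> q' \<notin> R.XO"
  using L.transH_partO L.transV_partO L.pair_in_trans[of r q]
    R.transH_partO R.transV_partO R.pair_in_trans[of r' q'] by auto

text \<open>A codeword confusable with \<open>(q, x)\<close> is not in the noncenter block, because
  \<open>q\<close> is an endpoint, nor in the vertical arm, because \<open>x\<close> in O is
  confusable with no endpoint. In the horizontal arm its second coordinate must be \<open>x\<close>;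
  over a vertex of O that arm consists of centers, and \<open>r\<close> is the only center
  confusable with \<open>q\<close>.\<close>

lemma private_left:
  assumes rq: "(r, q) \<in> gpairs g\<^sub>1" and x: "x \<in> R.XO"
  shows "private_pair P code (r, x) (q, x)"
proof (rule private_pairI[OF indep_product_code])
  note [simp] = L.pair_facts[OF rq]
  have xX: "x \<in> gaux g\<^sub>2" "x \<in> verts G\<^sub>2" using x R.parts_subset R.aux_subset by auto
  have e: "r \<in> transH g\<^sub>1 \<or> r \<in> transV g\<^sub>1" "q \<in> transH g\<^sub>1 \<or> q \<in> transV g\<^sub>1"
    using L.pair_in_trans[OF rq] by auto
  show "(r, x) \<in> code" unfolding product_code_def armH_eq using x by simp
  show "(q, x) \<in> verts P" "(q, x) \<noteq> (r, x)" using xX by simp_all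
  show "confusable P (r, x) (q, x)" using xX by (simp add: confusable_strong_product)
  fix b assume b: "b \<in> code" "confusable P b (q, x)"
  obtain b1 b2 where eq: "b = (b1, b2)" by fastforce
  have c: "confusable G\<^sub>1 b1 q" "confusable G\<^sub>2 b2 x"
    using confusable_strong_productD b eq by metis+
  have "b \<notin> noncenters g\<^sub>1 \<times> noncenters g\<^sub>2" using L.noncenter_endpoint c e eq by blast
  moreover have "b \<notin> AV" using R.partO_endpoint[OF x] c confusable_sym eq armV_D(2) by metis
  ultimately have bH: "b \<in> AH" using b by (auto simp: product_code_def)
  then have "b2 = x" using independentD[OF R.indep_aux] armH_D(2) xX c eq by metis
  moreover have "b1 \<in> centers g\<^sub>1"
    using bH x unfolding armH_def mapL_def eq by (simp add: calculation)
  then have "b1 = r" using L.center_private rq c by blast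
  ultimately show "b = (r, x)" using eq by simp
qed

text \<open>Mirror image of \<open>private_left\<close>, with the two arms exchanged.\<close>

lemma private_right:
  assumes rq: "(r, q) \<in> gpairs g\<^sub>2" and y: "y \<in> L.XO"
  shows "private_pair P code (y, r) (y, q)"
proof (rule private_pairI[OF indep_product_code])
  note [simp] = R.pair_facts[OF rq]
  have yX: "y \<in> gaux g\<^sub>1" "y \<in> verts G\<^sub>1" using y L.parts_subset L.aux_subset by auto
  have e: "r \<in> transH g\<^sub>2 \<or> r \<in> transV g\<^sub>2" "q \<in> transH g\<^sub>2 \<or> q \<in> transV g\<^sub>2"
    using R.pair_in_trans[OF rq] by auto
  show "(y, r) \<in> code" unfolding product_code_def armV_eq using y by simp
  show "(y, q) \<in> verts P" "(y, q) \<noteq> (y, r)" using yX by simp_all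
  show "confusable P (y, r) (y, q)" using yX by (simp add: confusable_strong_product)
  fix b assume b: "b \<in> code" "confusable P b (y, q)"
  obtain b1 b2 where eq: "b = (b1, b2)" by fastforce
  have c: "confusable G\<^sub>1 b1 y" "confusable G\<^sub>2 b2 q"
    using confusable_strong_productD b eq by metis+
  have "b \<notin> noncenters g\<^sub>1 \<times> noncenters g\<^sub>2" using R.noncenter_endpoint c e eq by blast
  moreover have "b \<notin> AH" using L.partO_endpoint[OF y] c confusable_sym eq armH_D(1) by metis
  ultimately have bV: "b \<in> AV" using b by (auto simp: product_code_def)
  then have "b1 = y" using independentD[OF L.indep_aux] armV_D(1) yX c eq by metis
  moreover have "b2 \<in> centers g\<^sub>2"
    using bV y unfolding armV_def mapK_def eq by (simp add: calculation)
  then have "b2 = r" using R.center_private rq c by blast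
  ultimately show "b = (y, r)" using eq by simp
qed

text \<open>Lifts from the same factor meet only if both the original pair and the vertex lifted
  along agree. Lifts from different factors never meet: one has an endpoint in the coordinate where
  the other has a vertex of O.\<close>

lemma disj_lifted_pairs: "disjoint_family_on endpoints lifted_pairs"
proof (unfold disjoint_family_on_def, intro ballI impI)
  fix m n assume mn: "m \<in> lifted_pairs" "n \<in> lifted_pairs" "m \<noteq> n"
  show "endpoints m \<inter> endpoints n = {}"
    using mn(1)
  proof (cases rule: lifted_pairs_cases)
    case (left r q x)
    note m = this
    from mn(2) show ?thesis
    proof (cases rule: lifted_pairs_cases)
      case (left r' q' x')
      then have "{r, q} \<inter> {r', q'} = {} \<or> x \<noteq> x'"
        using mn(3) m(3) L.pair_unique[OF m(1) left(1)] by metis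
      then show ?thesis using m(3) left(3) by (auto simp: endpoints_def)
    next
      case (right y' r' q')
      then show ?thesis
        using m pair_not_partO_left[OF m(1)] by (auto simp: endpoints_def)
    qed
  next
    case (right y r q)
    note m = this
    from mn(2) show ?thesis
    proof (cases rule: lifted_pairs_cases)
      case (left r' q' x')
      then show ?thesis
        using m pair_not_partO_right[OF m(1)] by (auto simp: endpoints_def)
    next
      case (right y' r' q')
      then have "{r, q} \<inter> {r', q'} = {} \<or> y \<noteq> y'"
        using mn(3) m(3) R.pair_unique[OF m(1) right(1)] by metis
      then show ?thesis using m(3) right(3) by (auto simp: endpoints_def)
    qed
  qed
qed

lemma lifted_pairs_left:
  "(r, q) \<in> gpairs g\<^sub>1 \<Longrightarrow> x \<in> R.XO \<Longrightarrow> ((r, x), (q, x)) \<in> lifted_pairs"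
  unfolding lifted_pairs_def by (rule UnI1, rule image_eqI[of _ _ "((r, q), x)"]) simp_all

lemma lifted_pairs_right:
  "(r, q) \<in> gpairs g\<^sub>2 \<Longrightarrow> y \<in> L.XO \<Longrightarrow> ((y, r), (y, q)) \<in> lifted_pairs"
  unfolding lifted_pairs_def by (rule UnI2, rule image_eqI[of _ _ "(y, (r, q))"]) simp_all

lemma lifted_endpoints:
  "(transH g\<^sub>1 \<union> transV g\<^sub>1) \<times> R.XO \<subseteq> (\<Union>p\<in>lifted_pairs. endpoints p)"
  "L.XO \<times> (transH g\<^sub>2 \<union> transV g\<^sub>2) \<subseteq> (\<Union>p\<in>lifted_pairs. endpoints p)"
proof -
  have "(e, x) \<in> (\<Union>p\<in>lifted_pairs. endpoints p)"
    if e: "e \<in> transH g\<^sub>1 \<or> e \<in> transV g\<^sub>1" "x \<in> R.XO" for e x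
  proof -
    obtain r q where "(r, q) \<in> gpairs g\<^sub>1" "e = r \<or> e = q"
      using L.trans_endpoint[OF e(1)] by blast
    then show ?thesis
      using lifted_pairs_left[of r q x] e(2) by (intro UN_I) (auto simp: endpoints_def)
  qed
  then show "(transH g\<^sub>1 \<union> transV g\<^sub>1) \<times> R.XO \<subseteq> (\<Union>p\<in>lifted_pairs. endpoints p)"
    by blast
  have "(y, e) \<in> (\<Union>p\<in>lifted_pairs. endpoints p)"
    if e: "e \<in> transH g\<^sub>2 \<or> e \<in> transV g\<^sub>2" "y \<in> L.XO" for e y
  proof -
    obtain r q where "(r, q) \<in> gpairs g\<^sub>2" "e = r \<or> e = q"
      using R.trans_endpoint[OF e(1)] by blast
    then show ?thesis
      using lifted_pairs_right[of r q y] e(2) by (intro UN_I) (auto simp: endpoints_def)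
  qed
  then show "L.XO \<times> (transH g\<^sub>2 \<union> transV g\<^sub>2) \<subseteq> (\<Union>p\<in>lifted_pairs. endpoints p)"
    by blast
qed

lemma lifted_transversals:
  "complementary_transversals lifted_pairs
    (transH g\<^sub>1 \<times> R.XO \<union> L.XO \<times> transV g\<^sub>2) (transV g\<^sub>1 \<times> R.XO \<union> L.XO \<times> transH g\<^sub>2)"
  unfolding complementary_transversals_def
proof (intro conjI)
  \<comment> \<open>The mixed intersections vanish because no endpoint of the first factor lies in
    \<open>L.XO\<close>.\<close>
  show "(transH g\<^sub>1 \<times> R.XO \<union> L.XO \<times> transV g\<^sub>2) \<inter>
      (transV g\<^sub>1 \<times> R.XO \<union> L.XO \<times> transH g\<^sub>2) = {}"
    using L.transversals_disjoint R.transversals_disjoint L.transH_partO L.transV_partO by blast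
  show "\<forall>(r, q)\<in>lifted_pairs.
      r \<in> transH g\<^sub>1 \<times> R.XO \<union> L.XO \<times> transV g\<^sub>2 \<and> q \<in> transV g\<^sub>1 \<times> R.XO \<union> L.XO \<times> transH g\<^sub>2 \<or>
      q \<in> transH g\<^sub>1 \<times> R.XO \<union> L.XO \<times> transV g\<^sub>2 \<and> r \<in> transV g\<^sub>1 \<times> R.XO \<union> L.XO \<times> transH g\<^sub>2"
    by (auto elim!: lifted_pairs_cases dest: L.pair_in_trans R.pair_in_trans)
qed (use lifted_endpoints in blast)+

text \<open>The two rectangles are separated in the first coordinate, where an endpoint would have
  to be confusable with a vertex of O. Leaving \<open>S\<close> and \<open>T\<close> open covers
  both new transversals.\<close>

lemma indep_lifted_trans:
  assumes "S = transH g\<^sub>1 \<or> S = transV g\<^sub>1" "T = transH g\<^sub>2 \<or> T = transV g\<^sub>2"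
  shows "independent P (S \<times> R.XO \<union> L.XO \<times> T)"
proof (intro independent_Un independent_Times fin_product L.fin R.fin)
  show "independent G\<^sub>1 S" using assms L.indep_transH L.indep_transV by auto
  show "independent G\<^sub>2 T" using assms R.indep_transH R.indep_transV by auto
  show "independent G\<^sub>1 L.XO" "independent G\<^sub>2 R.XO"
    using independent_mono L.indep_aux R.indep_aux L.parts_subset R.parts_subset by blast+
  show "\<not> confusable P u v" if "u \<in> S \<times> R.XO" "v \<in> L.XO \<times> T" for u v
    using that assms(1) L.partO_endpoint confusable_strong_productD(1)[of G\<^sub>1 G\<^sub>2]
      confusable_sym[of G\<^sub>1]
    by (cases u, cases v) blast
qed

text \<open>The closed neighborhood of a rectangle is the product of the closed neighborhoods of its
  sides, and within an independent auxiliary set the closed neighborhood of the O-part is the O-part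
  itself.\<close>

lemma aux_closed_nbhd:
  assumes "S \<subseteq> verts G\<^sub>1" "T \<subseteq> verts G\<^sub>2"
  shows "gaux g\<^sub>1 \<times> gaux g\<^sub>2 \<inter> closed_nbhd P (S \<times> R.XO \<union> L.XO \<times> T) =
    (gaux g\<^sub>1 \<inter> closed_nbhd G\<^sub>1 S) \<times> R.XO \<union> L.XO \<times> (gaux g\<^sub>2 \<inter> closed_nbhd G\<^sub>2 T)"
    (is "?l = ?r")
proof
  show "?l \<subseteq> ?r"
  proof (clarify)
    fix y x assume yx: "y \<in> gaux g\<^sub>1" "x \<in> gaux g\<^sub>2"
      and "(y, x) \<in> closed_nbhd P (S \<times> R.XO \<union> L.XO \<times> T)"
      and n: "\<not> (y \<in> L.XO \<and> x \<in> gaux g\<^sub>2 \<inter> closed_nbhd G\<^sub>2 T)"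
    then obtain u v where uv: "(u, v) \<in> S \<times> R.XO \<union> L.XO \<times> T" "confusable P (y, x) (u, v)"
      and "y \<in> verts G\<^sub>1" "x \<in> verts G\<^sub>2"
      by (auto simp: closed_nbhd_def)
    then have c: "confusable G\<^sub>1 y u" "confusable G\<^sub>2 x v"
      using confusable_strong_productD by metis+
    have "\<not> (u \<in> L.XO \<and> v \<in> T)"
      using n c yx independentD[OF L.indep_aux yx(1)] L.parts_subset \<open>x \<in> verts G\<^sub>2\<close>
      by (auto simp: closed_nbhd_def)
    then have "u \<in> S" "v \<in> R.XO" using uv by auto
    moreover have "x = v" using independentD[OF R.indep_aux yx(2)] c R.parts_subset calculation by blast
    ultimately show "y \<in> gaux g\<^sub>1 \<inter> closed_nbhd G\<^sub>1 S \<and> x \<in> R.XO"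
      using yx c \<open>y \<in> verts G\<^sub>1\<close> by (auto simp: closed_nbhd_def)
  qed
  have "(y, x) \<in> ?l" if yx: "y \<in> gaux g\<^sub>1" "y \<in> closed_nbhd G\<^sub>1 S" "x \<in> R.XO" for y x
  proof -
    obtain s where "s \<in> S" "confusable G\<^sub>1 y s" using yx by (auto simp: closed_nbhd_def)
    moreover have "y \<in> verts G\<^sub>1" "x \<in> verts G\<^sub>2" "x \<in> gaux g\<^sub>2"
      using yx L.aux_subset R.aux_subset R.parts_subset by auto
    moreover have "confusable P (y, x) (s, x)"
      using calculation assms by (subst confusable_strong_product) auto
    ultimately show ?thesis using yx by (auto simp: closed_nbhd_def)
  qed
  moreover have "(y, x) \<in> ?l" if yx: "x \<in> gaux g\<^sub>2" "x \<in> closed_nbhd G\<^sub>2 T" "y \<in> L.XO" for y x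
  proof -
    obtain s where "s \<in> T" "confusable G\<^sub>2 x s" using yx by (auto simp: closed_nbhd_def)
    moreover have "y \<in> verts G\<^sub>1" "x \<in> verts G\<^sub>2" "y \<in> gaux g\<^sub>1"
      using yx L.aux_subset R.aux_subset L.parts_subset by auto
    moreover have "confusable P (y, x) (y, s)"
      using calculation assms by (subst confusable_strong_product) auto
    ultimately show ?thesis using yx by (auto simp: closed_nbhd_def)
  qed
  ultimately show "?r \<subseteq> ?l" by blast
qed

lemma partH_product: "partH P product_gadget = L.XH \<times> R.XO \<union> L.XO \<times> R.XV"
  and partV_product: "partV P product_gadget = L.XV \<times> R.XO \<union> L.XO \<times> R.XH"
  using aux_closed_nbhd[OF L.transH_subset R.transV_subset]
    aux_closed_nbhd[OF L.transV_subset R.transH_subset]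
  by (simp_all add: partH_def partV_def product_gadget_def)

text \<open>Of the nine blocks formed by the parts of the two factors, the new H and V take the four
  with exactly one side in O; these five remain.\<close>

lemma partO_product:
  "partO P product_gadget = L.XO \<times> R.XO \<union> (L.XH \<union> L.XV) \<times> (R.XH \<union> R.XV)"
proof -
  have "partO P product_gadget =
      gaux g\<^sub>1 \<times> gaux g\<^sub>2 - (partH P product_gadget \<union> partV P product_gadget)"
    by (auto simp: partO_def partH_def partV_def product_gadget_def)
  also have "\<dots> = L.XO \<times> R.XO \<union> (L.XH \<union> L.XV) \<times> (R.XH \<union> R.XV)"
    unfolding partH_product partV_product
    using L.aux_split L.partO_partH L.partO_partV R.aux_split R.partO_partH R.partO_partV by blast
  finally show ?thesis .
qed

lemma is_gadget_product: "is_gadget P product_gadget"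
proof -
  \<comment> \<open>Disjointness of the two parts is the last gadget condition, and it can be read
    off from the rectangles.\<close>
  have "partH P product_gadget \<inter> partV P product_gadget = {}"
    unfolding partH_product partV_product
    using L.partO_partH L.partO_partV L.partH_partV R.partH_partV by blast
  then have "gaux product_gadget \<inter> closed_nbhd P (transH product_gadget)
      \<inter> closed_nbhd P (transV product_gadget) = {}"
    by (auto simp: partH_def partV_def)
  moreover have "\<forall>(r, q)\<in>lifted_pairs. private_pair P code r q"
    using private_left private_right by (auto elim!: lifted_pairs_cases)
  ultimately show ?thesis
    unfolding is_gadget_def
    using indep_product_code disj_lifted_pairs lifted_transversals
      indep_lifted_trans independent_Times[OF L.fin R.fin L.indep_aux R.indep_aux]
    by (simp add: product_gadget_def)
qed

section \<open>Parameters of the product gadget\<close>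

lemma card_lifted_pairs:
  "card lifted_pairs = card (gpairs g\<^sub>1) * card R.XO + card L.XO * card (gpairs g\<^sub>2)"
proof -
  let ?f = "\<lambda>((r, q), x). ((r, x), (q, x))" and ?g = "\<lambda>(y, (r, q)). ((y, r), (y, q))"
  have fin: "finite (gpairs g\<^sub>1)" "finite (gpairs g\<^sub>2)"
    using L.finite_pairs R.finite_pairs .
  \<comment> \<open>The first coordinates of a left lift are endpoints, those of a right lift lie in
    \<open>L.XO\<close>.\<close>
  have "?f ` (gpairs g\<^sub>1 \<times> R.XO) \<inter> ?g ` (L.XO \<times> gpairs g\<^sub>2) = {}"
    using pair_not_partO_left by auto
  then have "card lifted_pairs
      = card (?f ` (gpairs g\<^sub>1 \<times> R.XO)) + card (?g ` (L.XO \<times> gpairs g\<^sub>2))"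
    unfolding lifted_pairs_def
    using fin L.finite_parts R.finite_parts by (intro card_Un_disjoint) auto
  also have "card (?f ` (gpairs g\<^sub>1 \<times> R.XO)) = card (gpairs g\<^sub>1 \<times> R.XO)"
    by (rule card_image) (auto simp: inj_on_def)
  also have "card (?g ` (L.XO \<times> gpairs g\<^sub>2)) = card (L.XO \<times> gpairs g\<^sub>2)"
    by (rule card_image) (auto simp: inj_on_def)
  finally show ?thesis by (simp add: card_cartesian_product)
qed

lemma parameters_product:
  "parameters P product_gadget =
    (card code,
     card (gpairs g\<^sub>1) * card R.XO + card L.XO * card (gpairs g\<^sub>2),
     card (gaux g\<^sub>1) * card (gaux g\<^sub>2),
     card L.XO * card R.XO + (card L.XH + card L.XV) * (card R.XH + card R.XV),
     card L.XH * card R.XO + card L.XO * card R.XV,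
     card L.XV * card R.XO + card L.XO * card R.XH)"
proof -
  have "card (L.XH \<union> L.XV) = card L.XH + card L.XV" "card (R.XH \<union> R.XV) = card R.XH + card R.XV"
    using L.finite_parts L.partH_partV R.finite_parts R.partH_partV
    by (simp_all add: card_Un_disjoint)
  \<comment> \<open>Disjointness of the left sides, in the orientation in which
    \<open>card_two_blocks\<close> meets the rectangles.\<close>
  moreover have "L.XH \<inter> L.XO = {}" "L.XV \<inter> L.XO = {}" "L.XO \<inter> (L.XH \<union> L.XV) = {}"
    using L.partO_partH L.partO_partV by auto
  ultimately show ?thesis
    unfolding parameters_def partO_product partH_product partV_product
    using L.finite_parts R.finite_parts
    by (simp add: card_two_blocks card_lifted_pairs product_gadget_def card_cartesian_product)
qed

end

theorem lemma4:
  fixes G\<^sub>1 :: "'a sgraph" and G\<^sub>2 :: "'b sgraph"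
    and g\<^sub>1 :: "'a gadget" and g\<^sub>2 :: "'b gadget"
    and a\<^sub>1 t\<^sub>1 s\<^sub>1 o\<^sub>1 h\<^sub>1 v\<^sub>1 a\<^sub>2 t\<^sub>2 s\<^sub>2 o\<^sub>2 h\<^sub>2 v\<^sub>2 :: nat
  assumes "fin_simple_graph G\<^sub>1" and "fin_simple_graph G\<^sub>2"
    and "is_gadget G\<^sub>1 g\<^sub>1" and "is_gadget G\<^sub>2 g\<^sub>2"
    and "parameters G\<^sub>1 g\<^sub>1 = (a\<^sub>1, t\<^sub>1, s\<^sub>1, o\<^sub>1, h\<^sub>1, v\<^sub>1)"
    and "parameters G\<^sub>2 g\<^sub>2 = (a\<^sub>2, t\<^sub>2, s\<^sub>2, o\<^sub>2, h\<^sub>2, v\<^sub>2)"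
  shows "independent (G\<^sub>1 \<boxtimes> G\<^sub>2) (product_code G\<^sub>1 G\<^sub>2 g\<^sub>1 g\<^sub>2) \<and>
    int (card (product_code G\<^sub>1 G\<^sub>2 g\<^sub>1 g\<^sub>2)) =
      (int a\<^sub>1 - int t\<^sub>1) * (int a\<^sub>2 - int t\<^sub>2) + int t\<^sub>1 * int s\<^sub>2 + int s\<^sub>1 * int t\<^sub>2 \<and>
    (\<exists>g\<^sub>1\<^sub>2. is_gadget (G\<^sub>1 \<boxtimes> G\<^sub>2) g\<^sub>1\<^sub>2 \<and>
      gcode g\<^sub>1\<^sub>2 = product_code G\<^sub>1 G\<^sub>2 g\<^sub>1 g\<^sub>2 \<and>
      parameters (G\<^sub>1 \<boxtimes> G\<^sub>2) g\<^sub>1\<^sub>2 =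
        (card (product_code G\<^sub>1 G\<^sub>2 g\<^sub>1 g\<^sub>2),
         t\<^sub>1 * o\<^sub>2 + o\<^sub>1 * t\<^sub>2,
         s\<^sub>1 * s\<^sub>2,
         o\<^sub>1 * o\<^sub>2 + (h\<^sub>1 + v\<^sub>1) * (h\<^sub>2 + v\<^sub>2),
         h\<^sub>1 * o\<^sub>2 + o\<^sub>1 * v\<^sub>2,
         v\<^sub>1 * o\<^sub>2 + o\<^sub>1 * h\<^sub>2))"
proof -
  interpret gadget_product G\<^sub>1 g\<^sub>1 G\<^sub>2 g\<^sub>2
    using assms(1-4) by unfold_locales
  \<comment> \<open>The factors \<open>int a\<^sub>1 - int t\<^sub>1\<close> and
    \<open>int a\<^sub>2 - int t\<^sub>2\<close> are the sizes of the two noncenter sets.\<close>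
  have "int (card (product_code G\<^sub>1 G\<^sub>2 g\<^sub>1 g\<^sub>2)) =
      (int a\<^sub>1 - int t\<^sub>1) * (int a\<^sub>2 - int t\<^sub>2) + int t\<^sub>1 * int s\<^sub>2 + int s\<^sub>1 * int t\<^sub>2"
    using assms(5,6) L.card_noncenters R.card_noncenters
    by (simp add: card_product_code parameters_def)
  moreover have "gcode product_gadget = product_code G\<^sub>1 G\<^sub>2 g\<^sub>1 g\<^sub>2"
    by (simp add: product_gadget_def)
  ultimately show ?thesis
    using indep_product_code is_gadget_product parameters_product assms(5,6)
    by (intro conjI exI[of _ product_gadget]) (simp_all add: parameters_def)
qed

end
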